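(* For $n\ge1$ and any topological space $X$, the following are equivalent: $X\models_d\mathbb{C}_n$; $X\models_d\mathbb{C}_n^*$; $X\models_C\mathbb{C}_n$; $X$ is hereditarily $(n+1)$-irresolvable.
   Context: Modal formulas are built from variables by $\top,\neg,\wedge,\Box$, with $\Diamond=\neg\Box\neg$, $\Box^*\varphi=\varphi\wedge\Box\varphi$, $\Diamond^*\varphi=\varphi\vee\Diamond\varphi$. A topological model on $X$ assigns subsets of $X$ to variables; Boolean connectives are set operations. In C-semantics $\Diamond$ is interpreted as topological closure (and $\Box$ as interior); in d-semantics $\Diamond$ is interpreted as the derived set operator (set of limit points: $x$ is in the derived set of $Y$ iff every open neighbourhood of $x$ meets $Y\setminus\{x\}$), and $\Box=\neg\Diamond\neg$. $X\models_C\Sigma$ (resp. $X\models_d\Sigma$) means every instance of the scheme $\Sigma$ has truth set $X$ in every model on $X$ under C- (resp. d-) semantics. Define $\mathbb{P}_0(\varphi_0)=\Diamond\varphi_0$, $\mathbb{P}_n(\varphi_0,\dots,\varphi_n)=\Diamond(\varphi_1\wedge\mathbb{P}_{n-1}(\varphi_0,\varphi_2,\dots,\varphi_n))$ for $n>0$; $\mathbb{D}_n=\bigwedge_{i<j\le n}\neg(\varphi_i\wedge\varphi_j)$; $\mathbb{C}_n$ is the scheme $\Box^*\mathbb{D}_n\to(\Diamond\varphi_0\to\Diamond(\varphi_0\wedge\neg\mathbb{P}_n))$ and $\mathbb{C}_n^*$ is the scheme $\Box^*\mathbb{D}_n\to(\Diamond\varphi_0\to\Diamond^*(\varphi_0\wedge\neg\mathbb{P}_n))$.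 For $k\ge2$, a space is $k$-resolvable if it has $k$ pairwise disjoint dense subsets, $k$-irresolvable otherwise, and hereditarily $k$-irresolvable if every non-empty subspace is $k$-irresolvable. *)

theory Defs
  imports "HOL-Analysis.Analysis"
begin

section \<open>Modal formulas\<close>

datatype fm = Var nat | Top | Neg fm | And fm fm | Box fm

definition Or :: "fm \<Rightarrow> fm \<Rightarrow> fm" where
  "Or \<phi> \<psi> = Neg (And (Neg \<phi>) (Neg \<psi>))"

definition Imp :: "fm \<Rightarrow> fm \<Rightarrow> fm" where
  "Imp \<phi> \<psi> = Neg (And \<phi> (Neg \<psi>))"

definition Dia :: "fm \<Rightarrow> fm" where
  "Dia \<phi> = Neg (Box (Neg \<phi>))"

definition Box_star :: "fm \<Rightarrow> fm" where
  "Box_star \<phi> = And \<phi> (Box \<phi>)"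

definition Dia_star :: "fm \<Rightarrow> fm" where
  "Dia_star \<phi> = Or \<phi> (Dia \<phi>)"

definition Conj :: "fm list \<Rightarrow> fm" where
  "Conj \<phi>s = foldr And \<phi>s Top"

section \<open>Topological semantics\<close>

text \<open>The space is the carrier of \<open>X\<close>, so truth sets are taken relative to
  \<open>topspace X\<close>. The parameter \<open>B\<close> interprets the modality.\<close>

primrec truth_set ::
  "('a topology \<Rightarrow> 'a set \<Rightarrow> 'a set) \<Rightarrow> 'a topology \<Rightarrow> (nat \<Rightarrow> 'a set) \<Rightarrow> fm \<Rightarrow> 'a set" where
  "truth_set B X V (Var p) = V p"
| "truth_set B X V Top = topspace X"
| "truth_set B X V (Neg \<phi>) = topspace X - truth_set B X V \<phi>"
| "truth_set B X V (And \<phi> \<psi>) = truth_set B X V \<phi> \<inter> truth_set B X V \<psi>"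
| "truth_set B X V (Box \<phi>) = B X (truth_set B X V \<phi>)"

definition box_C :: "'a topology \<Rightarrow> 'a set \<Rightarrow> 'a set" where
  "box_C X A = X interior_of A"

definition box_d :: "'a topology \<Rightarrow> 'a set \<Rightarrow> 'a set" where
  "box_d X A = topspace X - X derived_set_of (topspace X - A)"

definition model_on :: "'a topology \<Rightarrow> (nat \<Rightarrow> 'a set) \<Rightarrow> bool" where
  "model_on X V \<longleftrightarrow> (\<forall>p. V p \<subseteq> topspace X)"

text \<open>A scheme is represented by the set of all its instances.\<close>

definition valid_C :: "'a topology \<Rightarrow> fm set \<Rightarrow> bool" where
  "valid_C X \<Sigma> \<longleftrightarrow> (\<forall>\<sigma>\<in>\<Sigma>. \<forall>V. model_on X V \<longrightarrow> truth_set box_C X V \<sigma> = topspace X)"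

definition valid_d :: "'a topology \<Rightarrow> fm set \<Rightarrow> bool" where
  "valid_d X \<Sigma> \<longleftrightarrow> (\<forall>\<sigma>\<in>\<Sigma>. \<forall>V. model_on X V \<longrightarrow> truth_set box_d X V \<sigma> = topspace X)"

lemma truth_set_subset_C: "model_on X V \<Longrightarrow> truth_set box_C X V \<phi> \<subseteq> topspace X"
  by (induction \<phi>)
     (auto simp: model_on_def box_C_def dest: subsetD[OF interior_of_subset_topspace])

lemma truth_set_subset_d: "model_on X V \<Longrightarrow> truth_set box_d X V \<phi> \<subseteq> topspace X"
  by (induction \<phi>) (auto simp: model_on_def box_d_def)

lemma truth_set_Dia_C:
  "model_on X V \<Longrightarrow> truth_set box_C X V (Dia \<phi>) = X closure_of (truth_set box_C X V \<phi>)"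
  by (simp add: Dia_def box_C_def closure_of_interior_of truth_set_subset_C double_diff)

lemma truth_set_Dia_d:
  "model_on X V \<Longrightarrow> truth_set box_d X V (Dia \<phi>) = X derived_set_of (truth_set box_d X V \<phi>)"
  by (simp add: Dia_def box_d_def truth_set_subset_d double_diff derived_set_of_subset_topspace)

section \<open>The schemes\<close>

text \<open>\<open>PP \<phi>\<^sub>0 [\<phi>\<^sub>1, \<dots>, \<phi>\<^sub>n]\<close> is \<open>P\<^sub>n(\<phi>\<^sub>0, \<dots>, \<phi>\<^sub>n)\<close>. In the
  remaining definitions the tuple \<open>\<phi>\<^sub>0, \<dots>, \<phi>\<^sub>n\<close> is given by a function on indices,
  of which only the values at \<open>0, \<dots>, n\<close> are used.\<close>

primrec PP :: "fm \<Rightarrow> fm list \<Rightarrow> fm" where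
  "PP \<phi>\<^sub>0 [] = Dia \<phi>\<^sub>0"
| "PP \<phi>\<^sub>0 (\<phi>\<^sub>1 # \<phi>s) = Dia (And \<phi>\<^sub>1 (PP \<phi>\<^sub>0 \<phi>s))"

definition PP_n :: "nat \<Rightarrow> (nat \<Rightarrow> fm) \<Rightarrow> fm" where
  "PP_n n \<phi> = PP (\<phi> 0) (map \<phi> [1..<n+1])"

definition DD :: "nat \<Rightarrow> (nat \<Rightarrow> fm) \<Rightarrow> fm" where
  "DD n \<phi> = Conj [Neg (And (\<phi> i) (\<phi> j)). j \<leftarrow> [0..<n+1], i \<leftarrow> [0..<j]]"

definition CC :: "nat \<Rightarrow> fm set" where
  "CC n = {Imp (Box_star (DD n \<phi>))
             (Imp (Dia (\<phi> 0)) (Dia (And (\<phi> 0) (Neg (PP_n n \<phi>))))) | \<phi>. True}"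

definition CC_star :: "nat \<Rightarrow> fm set" where
  "CC_star n = {Imp (Box_star (DD n \<phi>))
             (Imp (Dia (\<phi> 0)) (Dia_star (And (\<phi> 0) (Neg (PP_n n \<phi>))))) | \<phi>. True}"

section \<open>Resolvability\<close>

definition resolvable :: "nat \<Rightarrow> 'a topology \<Rightarrow> bool" where
  "resolvable k X \<longleftrightarrow>
     (\<exists>A :: nat \<Rightarrow> 'a set. disjoint_family_on A {..<k} \<and>
        (\<forall>i<k. A i \<subseteq> topspace X \<and> X closure_of A i = topspace X))"

definition hereditarily_irresolvable :: "nat \<Rightarrow> 'a topology \<Rightarrow> bool" where
  "hereditarily_irresolvable k X \<longleftrightarrow>
     (\<forall>S. S \<subseteq> topspace X \<and> S \<noteq> {} \<longrightarrow> \<not> resolvable k (subtopology X S))"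

end

theory Submission
  imports Defs
begin

text \<open>
  If \<open>\<C>\<^sub>n\<close> fails at \<open>x\<close> for sets \<open>A\<^sub>0, \<dots>, A\<^sub>n\<close>, then on some open neighbourhood \<open>U\<close> of \<open>x\<close>
  these sets are disjoint, and almost all of \<open>U \<inter> A\<^sub>0\<close> lies in \<open>P\<^sub>n\<close>. Unwinding \<open>P\<^sub>n\<close> yields
  disjoint sets \<open>B\<^sub>i \<subseteq> U \<inter> A\<^sub>i\<close> with \<open>B\<^sub>0 \<subseteq> cl B\<^sub>1\<close>, \<dots>, \<open>B\<^sub>n\<^sub>-\<^sub>1 \<subseteq> cl B\<^sub>n\<close>, \<open>B\<^sub>n \<subseteq> cl B\<^sub>0\<close>. Hence all
  \<open>B\<^sub>i\<close> have the same closure and resolve their union. In d-semantics \<open>x\<close> itself may be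
  missing from \<open>B\<^sub>0\<close>, which is harmless because \<open>x\<close> is a limit point of \<open>A\<^sub>0\<close>. Conversely,
  disjoint sets that are dense in a subspace lie in each other's derived sets, so they
  refute \<open>\<C>\<^sub>n\<close> in C-semantics and even \<open>\<C>\<^sub>n\<^sup>*\<close> in d-semantics.
\<close>

section \<open>Resolutions from cycles of closure inclusions\<close>

lemma resolvable_closure_cycle:
  assumes disj: "disjoint_family_on B {..n}"
    and top: "\<And>i. i \<le> n \<Longrightarrow> B i \<subseteq> topspace X"
    and step: "\<And>i. i < n \<Longrightarrow> B i \<subseteq> X closure_of B (Suc i)"
    and wrap: "B n \<subseteq> X closure_of B 0"
  shows "resolvable (Suc n) (subtopology X (\<Union>i\<le>n. B i))"
proof -
  have up: "B i \<subseteq> X closure_of B j" if "i \<le> j" "j \<le> n" for i j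
    using that
  proof (induction j rule: dec_induct)
    case base
    then show ?case by (simp add: closure_of_subset top)
  next
    case (step j)
    then have "X closure_of B j \<subseteq> X closure_of B (Suc j)"
      by (intro closure_of_minimal assms) auto
    with step show ?case by auto
  qed
  \<comment> \<open>One trip around the cycle, from \<open>i\<close> up to \<open>n\<close>, over to
    \<open>0\<close> and up to \<open>j\<close>, also covers \<open>j < i\<close>; each link
    composes because a closure is closed.\<close>
  have dense: "B i \<subseteq> X closure_of B j" if "i \<le> n" "j \<le> n" for i j
  proof -
    have "B i \<subseteq> X closure_of B n" using up that by blast
    also have "\<dots> \<subseteq> X closure_of B 0" by (intro closure_of_minimal wrap) auto
    also have "\<dots> \<subseteq> X closure_of B j"
      using up[of 0 j] that by (intro closure_of_minimal) auto
    finally show ?thesis .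
  qed
  let ?S = "\<Union>i\<le>n. B i"
  have "subtopology X ?S closure_of B j = topspace (subtopology X ?S)" if "j \<le> n" for j
  proof -
    have "?S \<inter> B j = B j" using that by auto
    moreover have "?S \<subseteq> topspace X" using top by auto
    moreover have "?S \<subseteq> X closure_of B j" using dense that by auto
    ultimately show ?thesis by (simp add: closure_of_subtopology Int_absorb1 Int_absorb2)
  qed
  moreover have "B j \<subseteq> topspace (subtopology X ?S)" if "j \<le> n" for j
    using top that by auto
  ultimately show ?thesis
    using disj unfolding resolvable_def lessThan_Suc_atMost less_Suc_eq_le by blast
qed

section \<open>Truth sets of the parts of the schemes\<close>

lemma truth_set_Imp:
  "truth_set B X V (Imp \<phi> \<psi>) = topspace X - (truth_set B X V \<phi> \<inter> (topspace X - truth_set B X V \<psi>))"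
  by (simp add: Imp_def)

lemma truth_set_Conj:
  "truth_set B X V (Conj \<phi>s) = topspace X \<inter> (\<Inter>\<phi>\<in>set \<phi>s. truth_set B X V \<phi>)"
  by (induction \<phi>s) (auto simp: Conj_def)

lemma truth_set_DD:
  "truth_set B X V (DD n \<phi>) =
    {x \<in> topspace X. \<forall>j\<le>n. \<forall>i<j. x \<notin> truth_set B X V (\<phi> i) \<or> x \<notin> truth_set B X V (\<phi> j)}"
proof -
  have "truth_set B X V (DD n \<phi>) = topspace X \<inter>
      (\<Inter>j\<in>{0..<n+1}. \<Inter>i\<in>{0..<j}. truth_set B X V (Neg (And (\<phi> i) (\<phi> j))))"
    by (simp add: DD_def truth_set_Conj del: upt_Suc)
  also have "\<dots> = {x \<in> topspace X.
      \<forall>j\<le>n. \<forall>i<j. x \<notin> truth_set B X V (\<phi> i) \<or> x \<notin> truth_set B X V (\<phi> j)}"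
    unfolding truth_set.simps set_eq_iff Int_iff INT_iff Diff_iff mem_Collect_eq
    by (auto simp: less_Suc_eq_le)
  finally show ?thesis .
qed

lemma truth_set_DD_disjoint:
  assumes "disjoint_family_on V {..n}"
  shows "truth_set B X V (DD n Var) = topspace X"
proof -
  have "V i \<inter> V j = {}" if "i < j" "j \<le> n" for i j
    using disjoint_family_onD[OF assms, of i j] that by simp
  then show ?thesis unfolding truth_set_DD by auto
qed

lemma truth_set_Box_star_C:
  "x \<in> truth_set box_C X V (Box_star \<phi>) \<longleftrightarrow> (\<exists>U. openin X U \<and> x \<in> U \<and> U \<subseteq> truth_set box_C X V \<phi>)"
  by (auto simp: Box_star_def box_C_def interior_of_def)

text \<open>In d-semantics \<open>Box\<close> controls only a punctured neighbourhood of
  \<open>x\<close>. The conjunct \<open>\<phi>\<close> in \<open>Box_star\<close> restores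
  \<open>x\<close> itself, so the reading is the same as in C-semantics.\<close>

lemma truth_set_Box_star_d:
  assumes "model_on X V"
  shows "x \<in> truth_set box_d X V (Box_star \<phi>) \<longleftrightarrow>
    (\<exists>U. openin X U \<and> x \<in> U \<and> U \<subseteq> truth_set box_d X V \<phi>)"
proof
  assume x: "x \<in> truth_set box_d X V (Box_star \<phi>)"
  then have "x \<in> topspace X" "x \<notin> X derived_set_of (topspace X - truth_set box_d X V \<phi>)"
    by (auto simp: Box_star_def box_d_def)
  then obtain U where U: "openin X U" "x \<in> U"
    and "\<forall>y\<in>U - {x}. y \<notin> topspace X - truth_set box_d X V \<phi>"
    unfolding in_derived_set_of by blast
  moreover have "x \<in> truth_set box_d X V \<phi>" using x by (simp add: Box_star_def)
  ultimately have "U \<subseteq> truth_set box_d X V \<phi>"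
    using openin_subset[OF U(1)] by blast
  with U show "\<exists>U. openin X U \<and> x \<in> U \<and> U \<subseteq> truth_set box_d X V \<phi>" by blast
next
  assume "\<exists>U. openin X U \<and> x \<in> U \<and> U \<subseteq> truth_set box_d X V \<phi>"
  then obtain U where U: "openin X U" "x \<in> U" "U \<subseteq> truth_set box_d X V \<phi>" by blast
  then have "x \<notin> X derived_set_of (topspace X - truth_set box_d X V \<phi>)"
    unfolding in_derived_set_of by blast
  with U show "x \<in> truth_set box_d X V (Box_star \<phi>)"
    using truth_set_subset_d[OF assms, of \<phi>] by (auto simp: Box_star_def box_d_def)
qed

section \<open>From hereditary irresolvability to validity\<close>

text \<open>A point of \<open>T\<close> would start a closure cycle through \<open>\<phi> 0\<close>,
  ..., \<open>\<phi> n\<close> inside \<open>U\<close>. Both semantics are served at once, since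
  closure and derived set both satisfy \<open>Dia\<close>. Density of \<open>T\<close> is assumed
  instead of equality with the truth set of \<open>\<phi> 0\<close> in \<open>U\<close>, so that a
  single point may be missing, as happens in d-semantics.\<close>

lemma irresolvable_PP_empty:
  fixes \<phi> :: "nat \<Rightarrow> fm"
  assumes irres: "hereditarily_irresolvable (Suc n) X"
    and Dia: "\<And>\<psi>. truth_set B X V (Dia \<psi>) \<subseteq> X closure_of truth_set B X V \<psi>"
    and U: "openin X U" "U \<subseteq> truth_set B X V (DD n \<phi>)"
    and T: "T = U \<inter> truth_set B X V (\<phi> 0) \<inter> truth_set B X V (PP_n n \<phi>)"
    and dense: "U \<inter> truth_set B X V (\<phi> 0) \<subseteq> X closure_of T"
  shows "T = {}"
proof (rule ccontr)
  assume "T \<noteq> {}"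
  define A where "A i = truth_set B X V (\<phi> i)" for i
  \<comment> \<open>\<open>Q i\<close> is what remains of P_n after index \<open>i\<close>:
    \<open>Q 0\<close> is all of P_n, and at \<open>i = n\<close> the list is empty, leaving the
    diamond of \<open>\<phi> 0\<close>.\<close>
  define Q where "Q i = truth_set B X V (PP (\<phi> 0) (map \<phi> [Suc i..<Suc n]))" for i
  \<comment> \<open>These sets form the cycle. By \<open>T'\<close> the value at \<open>0\<close>
    also has the form \<open>U \<inter> A i \<inter> Q i\<close>.\<close>
  define C where "C i = (if i = 0 then T else U \<inter> A i \<inter> Q i)" for i
  have UX: "U \<subseteq> topspace X" using U(1) by (rule openin_subset)
  have Qn: "Q n \<subseteq> X closure_of A 0"
    using Dia by (simp add: Q_def A_def)
  have Qi: "Q i \<subseteq> X closure_of (A (Suc i) \<inter> Q (Suc i))" if "i < n" for i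
  proof -
    have "[Suc i..<Suc n] = Suc i # [Suc (Suc i)..<Suc n]"
      using that by (simp add: upt_conv_Cons del: upt_Suc)
    then show ?thesis
      using Dia[of "And (\<phi> (Suc i)) (PP (\<phi> 0) (map \<phi> [Suc (Suc i)..<Suc n]))"]
      by (simp add: Q_def A_def del: upt_Suc)
  qed
  have T': "T = U \<inter> A 0 \<inter> Q 0"
    by (simp add: T A_def Q_def PP_n_def del: upt_Suc)
  \<comment> \<open>Openness of \<open>U\<close> lets each closure inclusion be cut down to
    \<open>U\<close>, where the sets \<open>A i\<close> are disjoint.\<close>
  have local: "U \<inter> X closure_of Z \<subseteq> X closure_of (U \<inter> Z)" for Z
    using U(1) by (rule openin_Int_closure_of_subset)
  have CU: "C i \<subseteq> U \<inter> A i \<inter> Q i" for i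
    by (auto simp: C_def T')
  have "resolvable (Suc n) (subtopology X (\<Union>i\<le>n. C i))"
  proof (rule resolvable_closure_cycle)
    have "A i \<inter> A j \<inter> U = {}" if "i < j" "j \<le> n" for i j
      using U(2) that unfolding truth_set_DD A_def by blast
    then have "A i \<inter> A j \<inter> U = {}" if "i \<noteq> j" "i \<le> n" "j \<le> n" for i j
      using that by (metis Int_commute linorder_neqE_nat)
    then show "disjoint_family_on C {..n}"
      unfolding disjoint_family_on_def using CU by (smt (verit) atMost_iff disjoint_iff Int_iff subset_iff)
    show "C i \<subseteq> topspace X" for i
      using CU UX by blast
    show "C i \<subseteq> X closure_of C (Suc i)" if "i < n" for i
    proof -
      have "C i \<subseteq> U \<inter> X closure_of (A (Suc i) \<inter> Q (Suc i))"
        using CU Qi[OF that] by blast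
      also have "\<dots> \<subseteq> X closure_of (C (Suc i))"
        using local by (simp add: C_def Int_assoc)
      finally show ?thesis .
    qed
    have "C n \<subseteq> U \<inter> X closure_of A 0"
      using CU Qn by blast
    also have "\<dots> \<subseteq> X closure_of (U \<inter> A 0)" by (rule local)
    \<comment> \<open>Closing the cycle: the last diamond only reaches \<open>A 0\<close>, and
      \<open>dense\<close> leads from there back to \<open>T\<close>.\<close>
    also have "\<dots> \<subseteq> X closure_of C 0"
      using dense by (intro closure_of_minimal) (auto simp: C_def A_def)
    finally show "C n \<subseteq> X closure_of C 0" .
  qed
  moreover have "(\<Union>i\<le>n. C i) \<subseteq> topspace X" using CU UX by blast
  moreover have "(\<Union>i\<le>n. C i) \<noteq> {}" using \<open>T \<noteq> {}\<close> by (auto simp: C_def)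
  ultimately show False using irres unfolding hereditarily_irresolvable_def by blast
qed

lemma valid_C_CC:
  assumes irres: "hereditarily_irresolvable (Suc n) X"
  shows "valid_C X (CC n)"
proof -
  have "x \<in> truth_set box_C X V (Dia (And (\<phi> 0) (Neg (PP_n n \<phi>))))"
    if V: "model_on X V" and D: "x \<in> truth_set box_C X V (Box_star (DD n \<phi>))"
      and x: "x \<in> truth_set box_C X V (Dia (\<phi> 0))" for V \<phi> x
  proof (rule ccontr)
    define A where "A = truth_set box_C X V (\<phi> 0)"
    define P where "P = truth_set box_C X V (PP_n n \<phi>)"
    have A: "A \<subseteq> topspace X" using truth_set_subset_C[OF V] by (simp add: A_def)
    assume "x \<notin> truth_set box_C X V (Dia (And (\<phi> 0) (Neg (PP_n n \<phi>))))"
    then have "x \<notin> X closure_of (A \<inter> (topspace X - P))"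
      by (simp add: truth_set_Dia_C[OF V] A_def P_def)
    moreover have xA: "x \<in> X closure_of A"
      using x by (simp add: truth_set_Dia_C[OF V] A_def)
    moreover have "x \<in> topspace X"
      using xA by (simp add: in_closure_of)
    ultimately obtain W where W: "openin X W" "x \<in> W"
      and "\<not> (\<exists>y. y \<in> A \<inter> (topspace X - P) \<and> y \<in> W)"
      unfolding in_closure_of by blast
    then have WA: "W \<inter> A \<subseteq> P"
      using A by blast
    obtain U where U: "openin X U" "x \<in> U" "U \<subseteq> truth_set box_C X V (DD n \<phi>)"
      using D unfolding truth_set_Box_star_C by blast
    have O: "openin X (U \<inter> W)" using U W by blast
    define T where "T = U \<inter> W \<inter> A \<inter> P"
    have TA: "T = U \<inter> W \<inter> A" using WA by (auto simp: T_def)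
    have "T = {}"
    proof (rule irresolvable_PP_empty[OF irres])
      show "truth_set box_C X V (Dia \<psi>) \<subseteq> X closure_of truth_set box_C X V \<psi>" for \<psi>
        by (simp add: truth_set_Dia_C[OF V])
      show "T = U \<inter> W \<inter> truth_set box_C X V (\<phi> 0) \<inter> truth_set box_C X V (PP_n n \<phi>)"
        by (simp add: T_def A_def P_def)
      \<comment> \<open>Here \<open>T\<close> is all of \<open>U \<inter> W \<inter> A\<close>, so
        density is immediate, while \<open>T = {}\<close> will contradict that \<open>x\<close> is
        in the closure of \<open>A\<close>.\<close>
      show "U \<inter> W \<inter> truth_set box_C X V (\<phi> 0) \<subseteq> X closure_of T"
        using A by (metis A_def TA closure_of_subset le_infI2)
    qed (use O U in auto)
    moreover have "x \<in> U \<inter> W" using U W by blast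
    then obtain y where "y \<in> A" "y \<in> U \<inter> W"
      using xA O unfolding in_closure_of by blast
    ultimately show False
      unfolding TA by blast
  qed
  then show ?thesis
    unfolding valid_C_def CC_def by (auto simp: truth_set_Imp)
qed

lemma valid_d_CC:
  assumes irres: "hereditarily_irresolvable (Suc n) X"
  shows "valid_d X (CC n)"
proof -
  have "x \<in> truth_set box_d X V (Dia (And (\<phi> 0) (Neg (PP_n n \<phi>))))"
    if V: "model_on X V" and D: "x \<in> truth_set box_d X V (Box_star (DD n \<phi>))"
      and x: "x \<in> truth_set box_d X V (Dia (\<phi> 0))" for V \<phi> x
  proof (rule ccontr)
    define A where "A = truth_set box_d X V (\<phi> 0)"
    define P where "P = truth_set box_d X V (PP_n n \<phi>)"
    have A: "A \<subseteq> topspace X" using truth_set_subset_d[OF V] by (simp add: A_def)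
    assume "x \<notin> truth_set box_d X V (Dia (And (\<phi> 0) (Neg (PP_n n \<phi>))))"
    then have "x \<notin> X derived_set_of (A \<inter> (topspace X - P))"
      by (simp add: truth_set_Dia_d[OF V] A_def P_def)
    moreover have xA: "x \<in> X derived_set_of A"
      using x by (simp add: truth_set_Dia_d[OF V] A_def)
    moreover have "x \<in> topspace X"
      using xA by (simp add: in_derived_set_of)
    ultimately obtain W where W: "openin X W" "x \<in> W"
      and "\<not> (\<exists>y. y \<noteq> x \<and> y \<in> A \<inter> (topspace X - P) \<and> y \<in> W)"
      unfolding in_derived_set_of by blast
    \<comment> \<open>A derived set says nothing about its base point, so \<open>x\<close> may
      belong to \<open>A\<close> without belonging to \<open>P\<close>.\<close>
    then have WA: "W \<inter> A \<subseteq> insert x P"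
      using A by blast
    obtain U where U: "openin X U" "x \<in> U" "U \<subseteq> truth_set box_d X V (DD n \<phi>)"
      using D unfolding truth_set_Box_star_d[OF V] by blast
    have O: "openin X (U \<inter> W)" using U W by blast
    define T where "T = U \<inter> W \<inter> A \<inter> P"
    have TA: "U \<inter> W \<inter> A - {x} \<subseteq> T" using WA by (auto simp: T_def)
    have limit: "\<exists>y. y \<noteq> x \<and> y \<in> A \<and> y \<in> N" if "openin X N" "x \<in> N" for N
      using xA that unfolding in_derived_set_of by blast
    \<comment> \<open>As a limit point of \<open>A\<close>, \<open>x\<close> has points of
      \<open>A\<close> other than itself arbitrarily near, and inside \<open>U \<inter> W\<close>
      these lie in \<open>T\<close>. Hence \<open>x\<close> is in the closure of \<open>T\<close>,
      which gives the required density and later contradicts \<open>T = {}\<close>.\<close>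
    have meet: "N \<inter> T \<noteq> {}" if "openin X N" "x \<in> N" for N
    proof -
      have "openin X (N \<inter> (U \<inter> W))" "x \<in> N \<inter> (U \<inter> W)"
        using openin_Int[OF that(1) O] that(2) U(2) W(2) by simp_all
      then obtain y where "y \<noteq> x" "y \<in> A" "y \<in> N \<inter> (U \<inter> W)"
        using limit by blast
      then show ?thesis using TA by blast
    qed
    have xT: "x \<in> X closure_of T"
      using meet xA unfolding in_closure_of in_derived_set_of by blast
    have "T = {}"
    proof (rule irresolvable_PP_empty[OF irres])
      show "truth_set box_d X V (Dia \<psi>) \<subseteq> X closure_of truth_set box_d X V \<psi>" for \<psi>
        by (simp add: truth_set_Dia_d[OF V] derived_set_of_subset_closure_of)
      show "T = U \<inter> W \<inter> truth_set box_d X V (\<phi> 0) \<inter> truth_set box_d X V (PP_n n \<phi>)"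
        by (simp add: T_def A_def P_def)
      have "T \<subseteq> X closure_of T"
        using A by (intro closure_of_subset) (auto simp: T_def)
      then show "U \<inter> W \<inter> truth_set box_d X V (\<phi> 0) \<subseteq> X closure_of T"
        using TA xT unfolding A_def by blast
    qed (use O U in auto)
    with xT show False by simp
  qed
  then show ?thesis
    unfolding valid_d_def CC_def by (auto simp: truth_set_Imp)
qed

section \<open>Countermodels from resolvable subspaces\<close>

text \<open>P_n follows the path 0, 1, ..., n, 0, read here backwards from its end. Every move is
  between distinct indices, the last one because \<open>n \<ge> 1\<close>; so mutual inclusions
  between different sets suffice.\<close>

lemma truth_set_PP_superset:
  assumes n: "n \<ge> 1"
    and Dia: "\<And>i j \<psi>. \<lbrakk>i \<le> n; j \<le> n; i \<noteq> j; V j \<subseteq> truth_set B X V \<psi>\<rbrakk> \<Longrightarrow> V i \<subseteq> truth_set B X V (Dia \<psi>)"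
  shows "V 0 \<subseteq> truth_set B X V (PP_n n Var)"
proof -
  have "V i \<subseteq> truth_set B X V (PP (Var 0) (map Var [Suc i..<Suc n]))" if "i \<le> n" for i
    using that
  proof (induction i rule: inc_induct)
    case base
    then show ?case using n Dia[of n 0 "Var 0"] by simp
  next
    case (step i)
    then have "[Suc i..<Suc n] = Suc i # [Suc (Suc i)..<Suc n]"
      by (simp add: upt_conv_Cons del: upt_Suc)
    then show ?case
      using step Dia[of i "Suc i" "And (Var (Suc i)) (PP (Var 0) (map Var [Suc (Suc i)..<Suc n]))"]
      by (simp del: upt_Suc)
  qed
  from this[of 0] show ?thesis by (simp add: PP_n_def del: upt_Suc)
qed

text \<open>Disjointness upgrades closure to derived set: a point of one dense set lies outside the
  other, so it can be approached only by different points.\<close>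

lemma not_irresolvable_derived_sets:
  assumes "\<not> hereditarily_irresolvable (Suc n) X"
  obtains V where "model_on X V" "disjoint_family_on V {..n}" "V 0 \<noteq> {}" "V n \<noteq> {}"
    "\<forall>i\<le>n. \<forall>j\<le>n. i \<noteq> j \<longrightarrow> V i \<subseteq> X derived_set_of V j"
proof -
  obtain S A where S: "S \<subseteq> topspace X" "S \<noteq> {}" and disj: "disjoint_family_on A {..n}"
    and A: "\<And>i. i \<le> n \<Longrightarrow> A i \<subseteq> S" "\<And>i. i \<le> n \<Longrightarrow> subtopology X S closure_of A i = S"
    using assms unfolding hereditarily_irresolvable_def resolvable_def
      lessThan_Suc_atMost less_Suc_eq_le by (metis inf.absorb_iff2 topspace_subtopology)
  have dense: "S \<subseteq> X closure_of A i" if "i \<le> n" for i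
    using A[OF that] by (auto simp: closure_of_subtopology Int_absorb1)
  have ne: "A i \<noteq> {}" if "i \<le> n" for i
    using dense[OF that] S by auto
  \<comment> \<open>The resolution is controlled only up to \<open>n\<close>; the empty default
    makes \<open>V\<close> a model on all variables.\<close>
  define V where "V i = (if i \<le> n then A i else {})" for i
  have "V i \<subseteq> X derived_set_of V j" if "i \<le> n" "j \<le> n" "i \<noteq> j" for i j
  proof -
    have "A i \<inter> A j = {}" using disj that by (auto simp: disjoint_family_on_def)
    moreover have "A i \<subseteq> X closure_of A j" using A(1) dense that by blast
    ultimately show ?thesis
      using that by (auto simp: V_def closure_of)
  qed
  moreover have "model_on X V" using A(1) S by (auto simp: model_on_def V_def)
  moreover have "disjoint_family_on V {..n}"
    using disj by (auto simp: V_def disjoint_family_on_def)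
  moreover have "V 0 \<noteq> {}" "V n \<noteq> {}" using ne by (auto simp: V_def)
  ultimately show thesis by (intro that[of V]) blast+
qed

lemma not_valid_C_CC:
  assumes "\<not> hereditarily_irresolvable (Suc n) X" and n: "n \<ge> 1"
  shows "\<not> valid_C X (CC n)"
proof
  assume valid: "valid_C X (CC n)"
  obtain V where V: "model_on X V" and disj: "disjoint_family_on V {..n}" and ne: "V 0 \<noteq> {}" "V n \<noteq> {}"
    and der: "\<forall>i\<le>n. \<forall>j\<le>n. i \<noteq> j \<longrightarrow> V i \<subseteq> X derived_set_of V j"
    using not_irresolvable_derived_sets[OF assms(1)] by metis
  have P: "V 0 \<subseteq> truth_set box_C X V (PP_n n Var)"
  proof (rule truth_set_PP_superset[OF n])
    show "V i \<subseteq> truth_set box_C X V (Dia \<psi>)"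
      if "i \<le> n" "j \<le> n" "i \<noteq> j" "V j \<subseteq> truth_set box_C X V \<psi>" for i j \<psi>
      using der[rule_format, OF that(1-3)] closure_of_mono[OF that(4), of X]
        derived_set_of_subset_topspace[of X "V j"]
      by (auto simp: truth_set_Dia_C[OF V] closure_of)
  qed
  obtain x where x: "x \<in> V 0" using ne by blast
  have "truth_set box_C X V (DD n Var) = topspace X"
    using disj by (rule truth_set_DD_disjoint)
  moreover have xX: "x \<in> topspace X" using x V by (auto simp: model_on_def)
  ultimately have "x \<in> truth_set box_C X V (Box_star (DD n Var))"
    unfolding truth_set_Box_star_C by blast
  moreover have "x \<in> truth_set box_C X V (Dia (Var 0))"
    using x V closure_of_subset[of "V 0" X]
    by (auto simp: truth_set_Dia_C[OF V] model_on_def)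
  moreover have "truth_set box_C X V (And (Var 0) (Neg (PP_n n Var))) = {}"
    using P by auto
  then have "truth_set box_C X V (Dia (And (Var 0) (Neg (PP_n n Var)))) = {}"
    by (simp only: truth_set_Dia_C[OF V] closure_of_empty)
  moreover have "truth_set box_C X V (Imp (Box_star (DD n Var))
      (Imp (Dia (Var 0)) (Dia (And (Var 0) (Neg (PP_n n Var)))))) = topspace X"
    using valid V unfolding valid_C_def CC_def by blast
  ultimately show False using xX by (auto simp: truth_set_Imp)
qed

lemma not_valid_d_CC_star:
  assumes "\<not> hereditarily_irresolvable (Suc n) X" and n: "n \<ge> 1"
  shows "\<not> valid_d X (CC_star n)"
proof
  assume valid: "valid_d X (CC_star n)"
  obtain V where V: "model_on X V" and disj: "disjoint_family_on V {..n}" and ne: "V 0 \<noteq> {}" "V n \<noteq> {}"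
    and der: "\<forall>i\<le>n. \<forall>j\<le>n. i \<noteq> j \<longrightarrow> V i \<subseteq> X derived_set_of V j"
    using not_irresolvable_derived_sets[OF assms(1)] by metis
  have P: "V 0 \<subseteq> truth_set box_d X V (PP_n n Var)"
  proof (rule truth_set_PP_superset[OF n])
    show "V i \<subseteq> truth_set box_d X V (Dia \<psi>)"
      if "i \<le> n" "j \<le> n" "i \<noteq> j" "V j \<subseteq> truth_set box_d X V \<psi>" for i j \<psi>
      using der[rule_format, OF that(1-3)] derived_set_of_mono[OF that(4)]
      by (auto simp: truth_set_Dia_d[OF V])
  qed
  \<comment> \<open>The point must be a limit point of \<open>V 0\<close>. The inclusions
    \<open>der\<close> relate distinct indices only, so it is taken from \<open>V n\<close> and not,
    as in C-semantics, from \<open>V 0\<close>.\<close>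
  obtain x where x: "x \<in> V n" using ne by blast
  have "truth_set box_d X V (DD n Var) = topspace X"
    using disj by (rule truth_set_DD_disjoint)
  moreover have xX: "x \<in> topspace X" using x V by (auto simp: model_on_def)
  ultimately have "x \<in> truth_set box_d X V (Box_star (DD n Var))"
    unfolding truth_set_Box_star_d[OF V] by blast
  moreover have "x \<in> truth_set box_d X V (Dia (Var 0))"
    using x n der[rule_format, of n 0] by (auto simp: truth_set_Dia_d[OF V])
  \<comment> \<open>Emptiness of this set refutes both disjuncts of \<open>Dia_star\<close>: truth
    at the point itself and truth at nearby points.\<close>
  moreover have E: "truth_set box_d X V (And (Var 0) (Neg (PP_n n Var))) = {}"
    using P by auto
  then have "truth_set box_d X V (Dia (And (Var 0) (Neg (PP_n n Var)))) = {}"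
    by (simp only: truth_set_Dia_d[OF V] derived_set_of_empty)
  with E have "truth_set box_d X V (Dia_star (And (Var 0) (Neg (PP_n n Var)))) = {}"
    unfolding Dia_star_def Or_def truth_set.simps(3,4)[of _ _ _ "Neg _"] truth_set.simps(3)
    by simp
  moreover have "truth_set box_d X V (Imp (Box_star (DD n Var))
      (Imp (Dia (Var 0)) (Dia_star (And (Var 0) (Neg (PP_n n Var)))))) = topspace X"
    using valid V unfolding valid_d_def CC_star_def by blast
  ultimately show False using xX by (auto simp: truth_set_Imp)
qed

lemma valid_d_CC_imp_CC_star:
  assumes "valid_d X (CC n)"
  shows "valid_d X (CC_star n)"
proof -
  have "truth_set box_d X V (Imp (Box_star (DD n \<phi>))
      (Imp (Dia (\<phi> 0)) (Dia_star (And (\<phi> 0) (Neg (PP_n n \<phi>)))))) = topspace X"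
    if V: "model_on X V" for V \<phi>
  proof -
    have "truth_set box_d X V (Dia \<psi>) \<subseteq> truth_set box_d X V (Dia_star \<psi>)" for \<psi>
      using truth_set_subset_d[OF V, of "Dia \<psi>"] by (auto simp: Dia_star_def Or_def)
    moreover have "truth_set box_d X V (Imp (Box_star (DD n \<phi>))
        (Imp (Dia (\<phi> 0)) (Dia (And (\<phi> 0) (Neg (PP_n n \<phi>)))))) = topspace X"
      using assms V unfolding valid_d_def CC_def by blast
    ultimately show ?thesis
      unfolding truth_set_Imp by blast
  qed
  then show ?thesis
    unfolding valid_d_def CC_star_def by blast
qed

theorem theorem8p4:
  fixes n :: nat and X :: "'a topology"
  assumes "n \<ge> 1"
  shows "(valid_d X (CC n) \<longleftrightarrow> valid_d X (CC_star n)) \<and>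
         (valid_d X (CC_star n) \<longleftrightarrow> valid_C X (CC n)) \<and>
         (valid_C X (CC n) \<longleftrightarrow> hereditarily_irresolvable (n + 1) X)"
  \<comment> \<open>Irresolvability yields \<open>CC\<close> in d-semantics, hence
    \<open>CC_star\<close>, hence irresolvability again; C-semantics is tied to irresolvability
    directly.\<close>
  using valid_C_CC[of n X] valid_d_CC[of n X] valid_d_CC_imp_CC_star[of X n]
    not_valid_C_CC[of n X] not_valid_d_CC_star[of n X] assms
  unfolding Suc_eq_plus1 by blast

end
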